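(* Any long welded knot is welded concordant to the unknot. That is, every virtual string link diagram on one strand is welded concordant to the diagram on one strand with no arrows.
   Context: Diagrams. A Gauss diagram consists of a skeleton (a finite disjoint union of oriented intervals and oriented circles) together with finitely many signed arrows (signs $\pm1$) whose endpoints (tail and head) are distinct points in the interior of the skeleton, considered up to orientation-preserving homeomorphism of the skeleton fixing the labels of the intervals. A virtual string link diagram on $n$ strands is (equivalently to a planar diagram with classical and virtual crossings) a Gauss diagram whose skeleton is $n$ oriented intervals labelled $1,\dots,n$ and no circles. An arrow represents a classical crossing, pointing from the overcrossing strand to the undercrossing strand; its sign is the writhe. Virtual crossings are not recorded. Two arrow endpoints are adjacent if they bound an arc of the skeleton with no other arrow endpoint in its interior. Reidemeister moves on Gauss diagrams. RM1: add or delete an arrow (any sign and direction) whose two endpoints are adjacent. RM2: add or delete two arrows of opposite signs whose tails are adjacent and whose heads are adjacent (in either relative order), the arcs between the tails and between the heads being disjoint. RM3: suppose there are three disjoint arcs $t,m,b$ of the skeleton and arrows $x:t\to m$, $y:t\to b$, $z:m\to b$, with no other endpoints on these arcs, and suppose there are $\delta,\varepsilon_t,\varepsilon_m,\varepsilon_b\in\{\pm1\}$ such that the signs of $x,y,z$ are $\delta\varepsilon_t\varepsilon_m$, $\delta\varepsilon_t\varepsilon_b$, $\delta\varepsilon_m\varepsilon_b$, and such that $x$ precedes $y$ on $t$ iff $\varepsilon_t=1$, $x$ precedes $z$ on $m$ iff $\varepsilon_m=1$, $y$ precedes $z$ on $b$ iff $\varepsilon_b=1$; then the order of the two endpoints is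 exchanged simultaneously on each of the three arcs. First forbidden move. $f1$ exchanges two adjacent arrow tails (arbitrary signs; "overcrossings commute"). Welded string links on $n$ strands are virtual string link diagrams modulo Reidemeister moves and $f1$. A long welded knot is a welded string link on one strand. Welded concordance. Two virtual string link diagrams on $n$ strands are welded concordant if one is obtained from the other by a finite sequence of Reidemeister moves, $f1$ moves, births (adding a circle to the skeleton carrying no arrow endpoints), deaths (deleting a circle carrying no arrow endpoints), and oriented saddle moves (choose two points of the skeleton that are not arrow endpoints, cut there and reconnect in the other orientation-respecting way), where $f1$ may be applied at any stage, such that the abstract surface described by the sequence (skeleton $\times$ interval, with disks attached for births and deaths and a band for each saddle) has precisely $n$ connected components, each containing exactly one strand of each end diagram, and each component has genus $0$. The genus of the $i$-th component is $(s_i-b_i-d_i)/2$, where $s_i,b_i,d_i$ are the numbers of saddles, births and deaths belonging to that component. *)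

theory Defs
  imports Complex_Main "HOL-Combinatorics.Transposition"
begin

datatype component = Strand nat | Circle nat

datatype arrow = Arrow (ident: nat) (positive: bool)

datatype 'a endpoint = Tail (arrow_of: 'a) | Head (arrow_of: 'a)

definition writhe :: "arrow \<Rightarrow> int" where
  "writhe a = (if positive a then 1 else - 1)"

text \<open>
  A diagram assigns to each component of its skeleton the word of arrow endpoints met along the
  component. Words on circles are only meaningful up to rotation. The numbers naming circles and
  arrows carry no information, see \<open>homeomorphic_via\<close> below. The number naming an interval is its
  label. After a saddle between two intervals, an interval keeps the label of its initial point;
  such a saddle puts two strands into the same component of the surface, so it never occurs in a
  concordance and the labels of terminal points need not be recorded.
\<close>

type_synonym diagram = "component \<Rightarrow> arrow endpoint list option"

definition endpoints :: "diagram \<Rightarrow> arrow endpoint set" where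
  "endpoints D = (\<Union>w \<in> ran D. set w)"

definition gauss_diagram :: "diagram \<Rightarrow> bool" where
  "gauss_diagram D \<longleftrightarrow>
     finite (dom D) \<and>
     (\<forall>w \<in> ran D. distinct w) \<and>
     (\<forall>c c' w w'. D c = Some w \<longrightarrow> D c' = Some w' \<longrightarrow> c \<noteq> c' \<longrightarrow> set w \<inter> set w' = {}) \<and>
     (\<forall>a. Tail a \<in> endpoints D \<longleftrightarrow> Head a \<in> endpoints D)"

definition string_link_diagram :: "nat \<Rightarrow> diagram \<Rightarrow> bool" where
  "string_link_diagram n D \<longleftrightarrow> gauss_diagram D \<and> dom D = Strand ` {1..n}"

definition trivial_diagram :: "nat \<Rightarrow> diagram" where
  "trivial_diagram n = (\<lambda>c. if c \<in> Strand ` {1..n} then Some [] else None)"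

text \<open>The words obtained from a given one by choosing a base point, if the component is a circle.\<close>

fun readings :: "component \<Rightarrow> 'e list \<Rightarrow> 'e list set" where
  "readings (Strand i) w = {w}"
| "readings (Circle j) w = range (\<lambda>k. rotate k w)"

definition homeomorphic_via :: "(component \<Rightarrow> component) \<Rightarrow> diagram \<Rightarrow> diagram \<Rightarrow> bool" where
  "homeomorphic_via \<phi> D D' \<longleftrightarrow>
     bij_betw \<phi> (dom D) (dom D') \<and>
     (\<forall>i. Strand i \<in> dom D \<longrightarrow> \<phi> (Strand i) = Strand i) \<and>
     (\<forall>j. Circle j \<in> dom D \<longrightarrow> \<phi> (Circle j) \<in> range Circle) \<and>
     (\<exists>\<rho>. inj_on \<rho> (arrow_of ` endpoints D) \<and>
          (\<forall>a \<in> arrow_of ` endpoints D. writhe (\<rho> a) = writhe a) \<and>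
          (\<forall>c w. D c = Some w \<longrightarrow>
             (\<exists>w' \<in> readings (\<phi> c) (map (map_endpoint \<rho>) w). D' (\<phi> c) = Some w')))"

text \<open>
  \<open>follows D e e'\<close>: some arc runs, along the orientation, from \<open>e\<close> to \<open>e'\<close> and has no endpoint in
  its interior. On a circle carrying exactly two endpoints each of them follows the other.
\<close>

definition follows :: "diagram \<Rightarrow> arrow endpoint \<Rightarrow> arrow endpoint \<Rightarrow> bool" where
  "follows D e e' \<longleftrightarrow> (\<exists>c w u v. D c = Some w \<and> u @ [e, e'] @ v \<in> readings c w)"

definition adjacent :: "diagram \<Rightarrow> arrow endpoint \<Rightarrow> arrow endpoint \<Rightarrow> bool" where
  "adjacent D e e' \<longleftrightarrow> follows D e e' \<or> follows D e' e"

definition delete_arrows :: "arrow set \<Rightarrow> diagram \<Rightarrow> diagram" where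
  "delete_arrows A D = (\<lambda>c. map_option (filter (\<lambda>e. arrow_of e \<notin> A)) (D c))"

definition exchange :: "arrow endpoint \<Rightarrow> arrow endpoint \<Rightarrow> diagram \<Rightarrow> diagram" where
  "exchange e e' D = (\<lambda>c. map_option (map (transpose e e')) (D c))"

text \<open>
  The first two moves are stated in the deleting direction. In all three moves the endpoints
  involved are distinct, so that arcs without interior endpoints are automatically disjoint.
\<close>

definition rm1 :: "diagram \<Rightarrow> diagram \<Rightarrow> bool" where
  "rm1 D D' \<longleftrightarrow> (\<exists>a. adjacent D (Tail a) (Head a) \<and> D' = delete_arrows {a} D)"

definition rm2 :: "diagram \<Rightarrow> diagram \<Rightarrow> bool" where
  "rm2 D D' \<longleftrightarrow> (\<exists>a b. writhe a = - writhe b \<and>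
     adjacent D (Tail a) (Tail b) \<and> adjacent D (Head a) (Head b) \<and> D' = delete_arrows {a, b} D)"

definition ordered_pair :: "diagram \<Rightarrow> int \<Rightarrow> arrow endpoint \<Rightarrow> arrow endpoint \<Rightarrow> bool" where
  "ordered_pair D \<epsilon> e e' \<longleftrightarrow> (if \<epsilon> = 1 then follows D e e' else follows D e' e)"

definition rm3 :: "diagram \<Rightarrow> diagram \<Rightarrow> bool" where
  "rm3 D D' \<longleftrightarrow>
     (\<exists>x y z. \<exists>\<delta> \<in> {1, - 1}. \<exists>\<epsilon>t \<in> {1, - 1}. \<exists>\<epsilon>m \<in> {1, - 1}. \<exists>\<epsilon>b \<in> {1, - 1}.
        distinct [x, y, z] \<and>
        writhe x = \<delta> * \<epsilon>t * \<epsilon>m \<and> writhe y = \<delta> * \<epsilon>t * \<epsilon>b \<and> writhe z = \<delta> * \<epsilon>m * \<epsilon>b \<and>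
        ordered_pair D \<epsilon>t (Tail x) (Tail y) \<and>
        ordered_pair D \<epsilon>m (Head x) (Tail z) \<and>
        ordered_pair D \<epsilon>b (Head y) (Head z) \<and>
        D' = exchange (Tail x) (Tail y) (exchange (Head x) (Tail z) (exchange (Head y) (Head z) D)))"

definition reidemeister :: "diagram \<Rightarrow> diagram \<Rightarrow> bool" where
  "reidemeister D D' \<longleftrightarrow> rm1 D D' \<or> rm1 D' D \<or> rm2 D D' \<or> rm2 D' D \<or> rm3 D D'"

definition f1 :: "diagram \<Rightarrow> diagram \<Rightarrow> bool" where
  "f1 D D' \<longleftrightarrow> (\<exists>a b. adjacent D (Tail a) (Tail b) \<and> D' = exchange (Tail a) (Tail b) D)"

text \<open>
  Oriented saddles. The two cut points lie on one interval, on one circle, on an interval and a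
  circle, on two circles, or on two intervals. The first argument collects the components of
  both diagrams that meet the saddle band.
\<close>

inductive saddle :: "component set \<Rightarrow> diagram \<Rightarrow> diagram \<Rightarrow> bool" where
  split_strand:
    "\<lbrakk>D (Strand i) = Some (u @ v @ w); Circle j \<notin> dom D\<rbrakk>
     \<Longrightarrow> saddle {Strand i, Circle j} D (D(Strand i \<mapsto> u @ w, Circle j \<mapsto> v))"
| split_circle:
    "\<lbrakk>D (Circle i) = Some w; u @ v \<in> readings (Circle i) w; Circle j \<notin> dom D\<rbrakk>
     \<Longrightarrow> saddle {Circle i, Circle j} D (D(Circle i \<mapsto> u, Circle j \<mapsto> v))"
| merge_strand_circle:
    "\<lbrakk>D (Strand i) = Some (u @ v); D (Circle j) = Some w; w' \<in> readings (Circle j) w\<rbrakk>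
     \<Longrightarrow> saddle {Strand i, Circle j} D (D(Strand i \<mapsto> u @ w' @ v, Circle j := None))"
| merge_circles:
    "\<lbrakk>i \<noteq> j; D (Circle i) = Some u; D (Circle j) = Some v;
      u' \<in> readings (Circle i) u; v' \<in> readings (Circle j) v\<rbrakk>
     \<Longrightarrow> saddle {Circle i, Circle j} D (D(Circle i \<mapsto> u' @ v', Circle j := None))"
| recombine_strands:
    "\<lbrakk>i \<noteq> j; D (Strand i) = Some (u @ v); D (Strand j) = Some (u' @ v')\<rbrakk>
     \<Longrightarrow> saddle {Strand i, Strand j} D (D(Strand i \<mapsto> u @ v', Strand j \<mapsto> u' @ v))"

datatype event = Deformation | Birth component | Death component | Saddle "component set"

text \<open>
  \<open>step D e T D'\<close>: the diagram \<open>D'\<close> arises from \<open>D\<close> by one move. The relation \<open>T\<close> records which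
  components of \<open>D\<close> and \<open>D'\<close> are joined by the piece of surface that the move sweeps out.
\<close>

inductive step :: "diagram \<Rightarrow> event \<Rightarrow> (component \<times> component) set \<Rightarrow> diagram \<Rightarrow> bool" where
  homeomorphism:
    "homeomorphic_via \<phi> D D' \<Longrightarrow> step D Deformation {(c, \<phi> c) | c. c \<in> dom D} D'"
| reidemeister:
    "reidemeister D D' \<Longrightarrow> step D Deformation (Id_on (dom D)) D'"
| f1:
    "f1 D D' \<Longrightarrow> step D Deformation (Id_on (dom D)) D'"
| birth:
    "Circle j \<notin> dom D \<Longrightarrow> step D (Birth (Circle j)) (Id_on (dom D)) (D(Circle j \<mapsto> []))"
| death:
    "D (Circle j) = Some []
     \<Longrightarrow> step D (Death (Circle j)) (Id_on (dom D - {Circle j})) (D(Circle j := None))"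
| saddle:
    "saddle P D D'
     \<Longrightarrow> step D (Saddle P) {(c, c') \<in> dom D \<times> dom D'. c = c' \<or> c \<in> P \<and> c' \<in> P} D'"

record movie =
  len :: nat
  frame :: "nat \<Rightarrow> diagram"
  event_at :: "nat \<Rightarrow> event"
  trace_at :: "nat \<Rightarrow> (component \<times> component) set"

definition valid_movie :: "movie \<Rightarrow> bool" where
  "valid_movie M \<longleftrightarrow>
     (\<forall>i \<le> len M. gauss_diagram (frame M i)) \<and>
     (\<forall>i < len M. step (frame M i) (event_at M i) (trace_at M i) (frame M (Suc i)))"

text \<open>
  The surface of a movie, seen through its level sets: a slice is a component of the skeleton of
  some frame, and the connected components of the surface are represented by the classes of
  slices under the equivalence relation generated by the traces of the moves.
\<close>

definition slices :: "movie \<Rightarrow> (nat \<times> component) set" where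
  "slices M = {(i, c). i \<le> len M \<and> c \<in> dom (frame M i)}"

definition glued :: "movie \<Rightarrow> ((nat \<times> component) \<times> (nat \<times> component)) set" where
  "glued M = {((i, c), (Suc i, c')) | i c c'. i < len M \<and> (c, c') \<in> trace_at M i}"

definition surface_components :: "movie \<Rightarrow> (nat \<times> component) set set" where
  "surface_components M = slices M // (glued M \<union> (glued M)\<inverse>)\<^sup>*"

definition num_saddles :: "movie \<Rightarrow> (nat \<times> component) set \<Rightarrow> nat" where
  "num_saddles M X = card {i. i < len M \<and> (\<exists>P. event_at M i = Saddle P \<and> (\<exists>c \<in> P. (i, c) \<in> X))}"

definition num_births :: "movie \<Rightarrow> (nat \<times> component) set \<Rightarrow> nat" where
  "num_births M X = card {i. i < len M \<and> (\<exists>c. event_at M i = Birth c \<and> (Suc i, c) \<in> X)}"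

definition num_deaths :: "movie \<Rightarrow> (nat \<times> component) set \<Rightarrow> nat" where
  "num_deaths M X = card {i. i < len M \<and> (\<exists>c. event_at M i = Death c \<and> (i, c) \<in> X)}"

definition genus :: "movie \<Rightarrow> (nat \<times> component) set \<Rightarrow> real" where
  "genus M X = (real (num_saddles M X) - real (num_births M X) - real (num_deaths M X)) / 2"

definition welded_concordant :: "nat \<Rightarrow> diagram \<Rightarrow> diagram \<Rightarrow> bool" where
  "welded_concordant n D D' \<longleftrightarrow>
     string_link_diagram n D \<and> string_link_diagram n D' \<and>
     (\<exists>M. valid_movie M \<and> frame M 0 = D \<and> frame M (len M) = D' \<and>
          card (surface_components M) = n \<and>
          (\<forall>X \<in> surface_components M.
             (\<exists>!i. i \<in> {1..n} \<and> (0, Strand i) \<in> X) \<and>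
             (\<exists>!i. i \<in> {1..n} \<and> (len M, Strand i) \<in> X) \<and>
             genus M X = 0))"

end

theory Submission
  imports Defs
begin

text \<open>
  Next to each head \<open>Head a\<close> of the strand, RM1 creates an arrow \<open>b\<close> of opposite sign, whose head
  follows \<open>Head a\<close>. A saddle then splits off a circle that carries just \<open>Head a\<close> and \<open>Head b\<close>.
  Once this is done for every head, the strand carries only tails. These commute by f1, so
  \<open>Tail a\<close> can be moved next to \<open>Tail b\<close>, and RM2 cancels \<open>a\<close> against \<open>b\<close>. The circles are now empty
  and die: there are as many deaths as saddles, and every circle was split off the strand, so the
  surface is connected of genus 0.
\<close>

section \<open>Gauss diagrams\<close>

text \<open>Speaking of endpoints rather than words turns disjointness of words into uniqueness of
  the component, and function updates then simplify pointwise.\<close>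

definition lies_on :: "diagram \<Rightarrow> component \<Rightarrow> arrow endpoint \<Rightarrow> bool" where
  "lies_on D c e \<longleftrightarrow> (\<exists>w. D c = Some w \<and> e \<in> set w)"

lemma lies_onI: "D c = Some w \<Longrightarrow> e \<in> set w \<Longrightarrow> lies_on D c e"
  by (simp add: lies_on_def)

lemma lies_on_upd [simp]:
  "lies_on (D(c \<mapsto> w)) c' e \<longleftrightarrow> (if c' = c then e \<in> set w else lies_on D c' e)"
  "lies_on (D(c := None)) c' e \<longleftrightarrow> c' \<noteq> c \<and> lies_on D c' e"
  by (auto simp: lies_on_def)

lemma endpoints_iff: "e \<in> endpoints D \<longleftrightarrow> (\<exists>c. lies_on D c e)"
  by (auto simp: endpoints_def ran_def lies_on_def)

lemma gauss_diagram_iff: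
  "gauss_diagram D \<longleftrightarrow>
     finite (dom D) \<and>
     (\<forall>c w. D c = Some w \<longrightarrow> distinct w) \<and>
     (\<forall>c c' e. lies_on D c e \<longrightarrow> lies_on D c' e \<longrightarrow> c = c') \<and>
     (\<forall>a. Tail a \<in> endpoints D \<longleftrightarrow> Head a \<in> endpoints D)"
  unfolding gauss_diagram_def ran_def lies_on_def by blast

lemma gauss_diagramD:
  assumes "gauss_diagram D"
  shows "finite (dom D)"
    and "D c = Some w \<Longrightarrow> distinct w"
    and "lies_on D c e \<Longrightarrow> lies_on D c' e \<Longrightarrow> c = c'"
    and "Tail a \<in> endpoints D \<longleftrightarrow> Head a \<in> endpoints D"
  using assms unfolding gauss_diagram_iff by blast+

section \<open>Fresh arrows and circles\<close>

lemma finite_endpoints: "gauss_diagram D \<Longrightarrow> finite (endpoints D)"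
  by (auto simp: gauss_diagram_def endpoints_def intro: finite_ran)

lemma fresh_arrow:
  assumes "gauss_diagram D"
  obtains b where "positive b = s" "Tail b \<notin> endpoints D" "Head b \<notin> endpoints D"
proof -
  have "finite (ident ` arrow_of ` endpoints D)"
    using finite_endpoints[OF assms] by simp
  then obtain n where n: "n \<notin> ident ` arrow_of ` endpoints D"
    using ex_new_if_finite[OF infinite_UNIV_nat] by metis
  have "e \<notin> endpoints D" if "arrow_of e = Arrow n s" for e
    using n that by (metis arrow.sel(1) imageI)
  then have "Tail (Arrow n s) \<notin> endpoints D" "Head (Arrow n s) \<notin> endpoints D"
    by simp_all
  then show ?thesis using that[of "Arrow n s"] by simp
qed

lemma fresh_circle:
  assumes "gauss_diagram D"
  obtains j where "Circle j \<notin> dom D"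
proof -
  have "finite (Circle -` dom D)"
    using gauss_diagramD(1)[OF assms] by (rule finite_vimageI) (simp add: inj_def)
  then obtain j where "j \<notin> Circle -` dom D"
    using ex_new_if_finite[OF infinite_UNIV_nat] by metis
  then show ?thesis using that by simp
qed

section \<open>Operations that keep a diagram a Gauss diagram\<close>

lemma dom_delete_arrows [simp]: "dom (delete_arrows A D) = dom D"
  by (auto simp: delete_arrows_def dom_def)

lemma dom_exchange [simp]: "dom (exchange e e' D) = dom D"
  by (auto simp: exchange_def dom_def)

lemma lies_on_delete_arrows [simp]:
  "lies_on (delete_arrows A D) c e \<longleftrightarrow> lies_on D c e \<and> arrow_of e \<notin> A"
  by (cases "D c") (auto simp: lies_on_def delete_arrows_def)

lemma gauss_delete_arrows:
  assumes "gauss_diagram D"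
  shows "gauss_diagram (delete_arrows A D)"
proof -
  have "\<And>c w. delete_arrows A D c = Some w \<Longrightarrow> distinct w"
    using gauss_diagramD(2)[OF assms] unfolding delete_arrows_def map_option_eq_Some by auto
  then show ?thesis
    using assms unfolding gauss_diagram_iff endpoints_iff by simp blast
qed

lemma delete_arrows_idem:
  assumes "\<And>e. e \<in> endpoints D \<Longrightarrow> arrow_of e \<notin> A"
  shows "delete_arrows A D = D"
proof
  fix c
  show "delete_arrows A D c = D c"
  proof (cases "D c")
    case (Some w)
    then have "\<forall>e \<in> set w. arrow_of e \<notin> A"
      using assms lies_onI unfolding endpoints_iff by metis
    then show ?thesis by (simp add: delete_arrows_def Some)
  qed (simp add: delete_arrows_def)
qed

lemma gauss_reorder:
  assumes "gauss_diagram D" "D c = Some w" "set w' = set w" "distinct w'"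
  shows "gauss_diagram (D(c \<mapsto> w'))"
proof -
  have "lies_on (D(c \<mapsto> w')) = lies_on D"
    using assms(2,3) by (auto simp: fun_eq_iff lies_on_def)
  then show ?thesis
    using assms(1,4) unfolding gauss_diagram_iff endpoints_iff by auto
qed

text \<open>This serves RM1 in its creating direction: both endpoints of the new arrow enter
  together, and neither occurs elsewhere.\<close>

lemma gauss_insert_isolated:
  assumes D: "gauss_diagram D" "D c = Some (u @ v)"
    and b: "Tail b \<notin> endpoints D" "Head b \<notin> endpoints D"
  shows "gauss_diagram (D(c \<mapsto> u @ [Head b, Tail b] @ v))" (is "gauss_diagram ?D")
proof -
  have lies: "lies_on ?D c' e \<longleftrightarrow> lies_on D c' e \<or> c' = c \<and> e \<in> {Head b, Tail b}" for c' e
    using D(2) by (auto simp: lies_on_def)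
  have ep: "endpoints ?D = {Head b, Tail b} \<union> endpoints D"
    unfolding set_eq_iff endpoints_iff lies Un_iff by blast
  have "\<not> lies_on D c' (Head b)" "\<not> lies_on D c' (Tail b)" for c'
    using b unfolding endpoints_iff by blast+
  then have "c1 = c2" if "lies_on ?D c1 e" "lies_on ?D c2 e" for c1 c2 e
    using that gauss_diagramD(3)[OF D(1), of c1 e c2] unfolding lies by blast
  moreover have "distinct (u @ [Head b, Tail b] @ v)"
    using gauss_diagramD(2)[OF D] lies_onI[of D c] D(2) b unfolding endpoints_iff by fastforce
  then have "distinct w" if "?D c' = Some w" for c' w
    using that gauss_diagramD(2)[OF D(1), of c' w] by (auto split: if_splits)
  moreover have "finite (dom ?D)" using gauss_diagramD(1)[OF D(1)] by simp
  moreover have "Tail a \<in> endpoints ?D \<longleftrightarrow> Head a \<in> endpoints ?D" for a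
    using gauss_diagramD(4)[OF D(1)] unfolding ep by simp
  ultimately show ?thesis unfolding gauss_diagram_iff by blast
qed

lemma gauss_split:
  assumes D: "gauss_diagram D" "D c = Some (u @ v @ w)" and c': "c' \<notin> dom D"
  shows "gauss_diagram (D(c \<mapsto> u @ w, c' \<mapsto> v))" (is "gauss_diagram ?D")
proof -
  have ne: "c \<noteq> c'" using D(2) c' by auto
  have c: "lies_on D c e \<longleftrightarrow> e \<in> set u \<union> set v \<union> set w" for e
    using D(2) by (auto simp: lies_on_def)
  have no: "\<not> lies_on D c' e" for e using c' by (auto simp: lies_on_def)
  have dist: "distinct (u @ v @ w)" using gauss_diagramD(2)[OF D] .
  \<comment> \<open>Folding \<open>c'\<close> back into \<open>c\<close> locates every endpoint of
    the split diagram in \<open>D\<close>. Uniqueness of components then only needs \<open>v\<close>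
    to be disjoint from \<open>u\<close> and \<open>w\<close>.\<close>
  have from_D: "lies_on D (if c1 = c' then c else c1) e" if "lies_on ?D c1 e" for c1 e
    using that ne by (auto simp: c split: if_splits)
  have "(\<exists>c1. lies_on ?D c1 e) \<longleftrightarrow> (\<exists>c1. lies_on D c1 e)" for e
  proof
    assume "\<exists>c1. lies_on D c1 e"
    then obtain c1 where c1: "lies_on D c1 e" by blast
    show "\<exists>c1. lies_on ?D c1 e"
    proof (cases "c1 = c \<and> e \<in> set v")
      case True
      then show ?thesis by (intro exI[of _ c']) simp
    next
      case False
      then show ?thesis using c1 c no by (intro exI[of _ c1]) auto
    qed
  qed (use from_D in blast)
  then have ep: "endpoints ?D = endpoints D" unfolding set_eq_iff endpoints_iff by blast
  have "c1 = c2" if l: "lies_on ?D c1 e" "lies_on ?D c2 e" for c1 c2 e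
  proof -
    have "(if c1 = c' then c else c1) = (if c2 = c' then c else c2)"
      using gauss_diagramD(3)[OF D(1)] l[THEN from_D] by blast
    moreover have "set v \<inter> (set u \<union> set w) = {}" using dist by auto
    ultimately show ?thesis using l by (auto split: if_splits)
  qed
  moreover have "distinct (u @ w)" "distinct v" using dist by auto
  then have "distinct w1" if "?D c1 = Some w1" for c1 w1
    using that gauss_diagramD(2)[OF D(1), of c1 w1] by (auto split: if_splits)
  moreover have "finite (dom ?D)" using gauss_diagramD(1)[OF D(1)] by simp
  moreover have "Tail a \<in> endpoints ?D \<longleftrightarrow> Head a \<in> endpoints ?D" for a
    using gauss_diagramD(4)[OF D(1)] unfolding ep .
  ultimately show ?thesis unfolding gauss_diagram_iff by blast
qed

lemma gauss_remove_empty: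
  assumes "gauss_diagram D" "D c = Some []"
  shows "gauss_diagram (D(c := None))"
proof -
  have "lies_on (D(c := None)) = lies_on D"
    using assms(2) by (auto simp: fun_eq_iff lies_on_def)
  then show ?thesis
    using assms(1) unfolding gauss_diagram_iff endpoints_iff by auto
qed

section \<open>Evolutions without births\<close>

text \<open>The contribution of an event to \<open>s - b - d\<close>, which is twice the
  genus.\<close>

fun excess :: "event \<Rightarrow> int" where
  "excess Deformation = 0"
| "excess (Birth c) = - 1"
| "excess (Death c) = - 1"
| "excess (Saddle P) = 1"

text \<open>A movie reduced to its two ends and its total excess. Excluding births ensures that
  every component can be traced back to the initial diagram, which makes the surface connected when
  that diagram is a single strand.\<close>

inductive evolves :: "int \<Rightarrow> diagram \<Rightarrow> diagram \<Rightarrow> bool" where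
  stay: "gauss_diagram D \<Longrightarrow> evolves 0 D D"
| move: "\<lbrakk>evolves k D D'; step D' e T D''; gauss_diagram D''; e \<notin> range Birth; l = k + excess e\<rbrakk>
         \<Longrightarrow> evolves l D D''"

text \<open>\<open>move\<close> appends at the end, so the induction runs over the later evolution,
  which is therefore the first premise.\<close>

lemma evolves_trans:
  assumes "evolves l D' D''" "evolves k D D'"
  shows "evolves (k + l) D D''"
  using assms
proof (induction rule: evolves.induct)
  case (move l D' D'' e T D''' m)
  then have "evolves (k + l) D D''" by blast
  from evolves.move[OF this move.hyps(2-4)] show ?case
    using move.hyps(5) by (simp add: add.assoc)
qed simp

lemma evolves_gauss: "evolves k D D' \<Longrightarrow> gauss_diagram D'"
  by (induction rule: evolves.induct) auto

lemma evolves_step: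
  assumes "gauss_diagram D" "step D e T D'" "gauss_diagram D'" "e \<notin> range Birth"
  shows "evolves (excess e) D D'"
  using evolves.move[OF evolves.stay[OF assms(1)] assms(2-4)] by simp

lemmas evolves_reidemeister = evolves_step[OF _ step.reidemeister, simplified image_iff, simplified]
  and evolves_f1 = evolves_step[OF _ step.f1, simplified image_iff, simplified]
  and evolves_death = evolves_step[OF _ step.death, simplified image_iff, simplified]
  and evolves_saddle = evolves_step[OF _ step.saddle, simplified image_iff, simplified]

lemma evolves_movie:
  assumes "evolves k D D'"
  shows "\<exists>M. valid_movie M \<and> frame M 0 = D \<and> frame M (len M) = D' \<and>
           (\<forall>i < len M. event_at M i \<notin> range Birth) \<and> (\<Sum>i < len M. excess (event_at M i)) = k"
  using assms
proof (induction rule: evolves.induct)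
  case (stay D)
  then show ?case
    \<comment> \<open>At length 0 no event or trace is ever consulted, so these fields are
      arbitrary.\<close>
    by (intro exI[of _ "\<lparr>len = 0, frame = \<lambda>_. D, event_at = \<lambda>_. Deformation, trace_at = \<lambda>_. {}\<rparr>"])
      (simp add: valid_movie_def)
next
  case (move k D D' e T D'' l)
  then obtain M where M: "valid_movie M" "frame M 0 = D" "frame M (len M) = D'"
    "\<forall>i < len M. event_at M i \<notin> range Birth" "(\<Sum>i < len M. excess (event_at M i)) = k"
    by blast
  \<comment> \<open>The new event and trace sit at index \<open>len M\<close>, the frame they
    produce at \<open>Suc (len M)\<close>.\<close>
  define N where "N = \<lparr>len = Suc (len M), frame = (frame M)(Suc (len M) := D''),
    event_at = (event_at M)(len M := e), trace_at = (trace_at M)(len M := T)\<rparr>"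
  have "gauss_diagram (frame N i)" if "i \<le> len N" for i
    using M(1) move.hyps(3) that by (auto simp: valid_movie_def N_def le_Suc_eq)
  moreover have "step (frame N i) (event_at N i) (trace_at N i) (frame N (Suc i))"
    if "i < len N" for i
    using M(1,3) move.hyps(2) that by (cases "i = len M") (auto simp: valid_movie_def N_def)
  ultimately have "valid_movie N" unfolding valid_movie_def by blast
  moreover have "frame N 0 = D" "frame N (len N) = D''" using M by (auto simp: N_def)
  moreover have "\<forall>i < len N. event_at N i \<notin> range Birth"
    using M move.hyps by (auto simp: N_def less_Suc_eq)
  moreover have "(\<Sum>i < len N. excess (event_at N i)) = l"
    using M move.hyps by (simp add: N_def)
  ultimately show ?case by (intro exI[of _ N] conjI)
qed

section \<open>The surface of an evolution\<close>

text \<open>\<open>P\<close> may contain a circle that exists only after the saddle, so only some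
  member is available before it. That one suffices both as an ancestor of new components and for
  counting the saddle.\<close>

lemma saddle_meets_dom: "saddle P D D' \<Longrightarrow> \<exists>c \<in> P. c \<in> dom D"
  by (induction rule: saddle.induct) (blast intro: domI)+

lemma saddle_dom_subset: "saddle P D D' \<Longrightarrow> dom D' \<subseteq> dom D \<union> P"
  by (induction rule: saddle.induct) (auto simp del: readings.simps)

lemma reidemeister_dom: "reidemeister D D' \<Longrightarrow> dom D' = dom D"
  unfolding reidemeister_def rm1_def rm2_def rm3_def by (elim disjE exE bexE conjE; simp)

lemma f1_dom: "f1 D D' \<Longrightarrow> dom D' = dom D"
  unfolding f1_def by (elim exE conjE) simp

text \<open>The second claim provides ancestors: a component that a saddle creates lies in
  \<open>P\<close> and is traced to a member of \<open>P\<close> already present. Only a birth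
  produces a component without an ancestor.\<close>

lemma step_trace:
  assumes "step D e T D'"
  shows "T \<subseteq> dom D \<times> dom D'"
    and "e \<notin> range Birth \<Longrightarrow> dom D' \<subseteq> Range T"
proof -
  have "T \<subseteq> dom D \<times> dom D' \<and> (e \<notin> range Birth \<longrightarrow> dom D' \<subseteq> Range T)"
    using assms
  proof cases
    case (homeomorphism \<phi>)
    from homeomorphism(3) have img: "\<phi> ` dom D = dom D'"
      unfolding homeomorphic_via_def by (elim conjE) (rule bij_betw_imp_surj_on)
    have graph: "{(c, \<phi> c) | c. c \<in> A} \<subseteq> A \<times> \<phi> ` A"
      "\<phi> ` A \<subseteq> Range {(c, \<phi> c) | c. c \<in> A}" for A by auto
    show ?thesis
      using graph[of "dom D"] unfolding homeomorphism(2) img by (intro conjI impI)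
  next
    case reidemeister
    then show ?thesis using reidemeister_dom[of D D'] by blast
  next
    case f1
    then show ?thesis using f1_dom[of D D'] by blast
  next
    case (saddle P)
    then show ?thesis using saddle_meets_dom[of P D D'] saddle_dom_subset[of P D D'] by blast
  next
    case (death j)
    from death(3) have "dom D' = dom D - {Circle j}" by (simp only: dom_fun_upd simp_thms if_True)
    with death(2) show ?thesis by blast
  qed auto
  then show "T \<subseteq> dom D \<times> dom D'" "e \<notin> range Birth \<Longrightarrow> dom D' \<subseteq> Range T" by auto
qed

text \<open>The closure in \<open>surface_components\<close> is a relation on all pairs; this keeps
  the class of a slice within the slices.\<close>

lemma glued_subset_slices:
  assumes "valid_movie M"
  shows "glued M \<subseteq> slices M \<times> slices M"
proof
  fix p
  assume "p \<in> glued M"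
  then obtain i c c' where p: "p = ((i, c), (Suc i, c'))" "i < len M" "(c, c') \<in> trace_at M i"
    unfolding glued_def by blast
  then have "step (frame M i) (event_at M i) (trace_at M i) (frame M (Suc i))"
    using assms unfolding valid_movie_def by blast
  then have "c \<in> dom (frame M i)" "c' \<in> dom (frame M (Suc i))"
    using step_trace(1) p(3) by blast+
  then show "p \<in> slices M \<times> slices M" using p(1,2) by (simp add: slices_def)
qed

text \<open>Ancestors are followed back frame by frame until frame 0, whose only slice is
  \<open>c0\<close>.\<close>

lemma slice_connected_to_start:
  assumes M: "valid_movie M" "\<forall>i < len M. event_at M i \<notin> range Birth"
    and start: "dom (frame M 0) = {c0}"
    and "i \<le> len M" "c \<in> dom (frame M i)"
  shows "((0, c0), (i, c)) \<in> (glued M)\<^sup>*"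
  using assms(4,5)
proof (induction i arbitrary: c)
  case 0
  then show ?case using start by auto
next
  case (Suc i)
  have i: "i < len M" using Suc.prems(1) by simp
  have st: "step (frame M i) (event_at M i) (trace_at M i) (frame M (Suc i))"
    using M(1) i unfolding valid_movie_def by blast
  have "event_at M i \<notin> range Birth" using M(2) i by blast
  then have "c \<in> Range (trace_at M i)" using step_trace(2)[OF st] Suc.prems(2) by blast
  then obtain c' where c': "(c', c) \<in> trace_at M i" by blast
  then have "c' \<in> dom (frame M i)" using step_trace(1)[OF st] by blast
  then have "((0, c0), (i, c')) \<in> (glued M)\<^sup>*" using Suc.IH i by simp
  moreover have "((i, c'), (Suc i, c)) \<in> glued M"
    using c' i unfolding glued_def by blast
  ultimately show ?case by (rule rtrancl.rtrancl_into_rtrancl)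
qed

lemma surface_connected:
  assumes M: "valid_movie M" "\<forall>i < len M. event_at M i \<notin> range Birth"
    and start: "dom (frame M 0) = {c0}"
  shows "surface_components M = {slices M}"
proof -
  let ?r = "(glued M \<union> (glued M)\<inverse>)\<^sup>*"
  have sym: "sym ?r" by (intro sym_rtrancl sym_Un_converse)
  have to: "((0, c0), y) \<in> ?r" if "y \<in> slices M" for y
    using slice_connected_to_start[OF assms] that
      rtrancl_mono[of "glued M" "glued M \<union> (glued M)\<inverse>"]
    by (auto simp: slices_def)
  have closed: "y \<in> slices M" if "(x, y) \<in> ?r" "x \<in> slices M" for x y
    using that glued_subset_slices[OF M(1)] by (induction rule: rtrancl_induct) auto
  have "?r `` {x} = slices M" if "x \<in> slices M" for x
  proof -
    have "(x, y) \<in> ?r" if "y \<in> slices M" for y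
      using symD[OF sym to[OF \<open>x \<in> slices M\<close>]] to[OF that] by (rule rtrancl_trans)
    then show ?thesis using closed that by blast
  qed
  moreover have "(0, c0) \<in> slices M" using start by (auto simp: slices_def)
  ultimately show ?thesis unfolding surface_components_def quotient_def by auto
qed

text \<open>For the set of all slices the membership conditions in the three counts hold
  automatically, so the counts are plain numbers of events.\<close>

lemma genus_slices:
  assumes M: "valid_movie M" "\<forall>i < len M. event_at M i \<notin> range Birth"
  shows "genus M (slices M) = real_of_int (\<Sum>i < len M. excess (event_at M i)) / 2"
proof -
  let ?S = "{i \<in> {..<len M}. \<exists>P. event_at M i = Saddle P}"
  let ?K = "{i \<in> {..<len M}. \<exists>c. event_at M i = Death c}"
  have st: "step (frame M i) (event_at M i) (trace_at M i) (frame M (Suc i))" if "i < len M" for i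
    using M(1) that unfolding valid_movie_def by auto
  have "\<exists>c \<in> P. (i, c) \<in> slices M" if "i < len M" "event_at M i = Saddle P" for i P
    using st[OF that(1)] that saddle_meets_dom
    by (cases rule: step.cases) (fastforce simp: slices_def)+
  then have S: "num_saddles M (slices M) = card ?S"
    unfolding num_saddles_def by (intro arg_cong[where f = card]) auto
  have "(i, c) \<in> slices M" if "i < len M" "event_at M i = Death c" for i c
    using st[OF that(1)] that by (cases rule: step.cases) (auto simp: slices_def)
  then have K: "num_deaths M (slices M) = card ?K"
    unfolding num_deaths_def by (intro arg_cong[where f = card]) auto
  have B: "num_births M (slices M) = 0"
    using M(2) unfolding num_births_def by (subst card_eq_0_iff) auto
  \<comment> \<open>Without births, the excess is the indicator of saddles minus that of
    deaths.\<close>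
  have "excess (event_at M i) = of_bool (i \<in> ?S) - of_bool (i \<in> ?K)" if "i < len M" for i
    using M(2) that by (cases "event_at M i") auto
  then have "(\<Sum>i < len M. excess (event_at M i)) = (\<Sum>i < len M. of_bool (i \<in> ?S) - of_bool (i \<in> ?K))"
    by (intro sum.cong) auto
  also have "\<dots> = int (card ?S) - int (card ?K)"
    by (simp add: sum_subtractf sum.If_cases of_bool_def Int_def)
  finally show ?thesis unfolding genus_def S K B by simp
qed

text \<open>Total excess 0 is genus 0 of the single surface component, which contains the strand at
  both ends.\<close>

lemma welded_concordant_1I:
  assumes "string_link_diagram 1 D" "string_link_diagram 1 D'" "evolves 0 D D'"
  shows "welded_concordant 1 D D'"
proof -
  obtain M where M: "valid_movie M" "frame M 0 = D" "frame M (len M) = D'"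
    "\<forall>i < len M. event_at M i \<notin> range Birth" "(\<Sum>i < len M. excess (event_at M i)) = 0"
    using evolves_movie[OF assms(3)] by blast
  have dom: "dom D = {Strand 1}" "dom D' = {Strand 1}"
    using assms(1,2) by (auto simp: string_link_diagram_def)
  have comp: "surface_components M = {slices M}"
    using surface_connected M dom by blast
  have ends: "(0, Strand 1) \<in> slices M" "(len M, Strand 1) \<in> slices M"
    using M dom by (auto simp: slices_def)
  have "genus M (slices M) = 0" unfolding genus_slices[OF M(1,4)] M(5) by simp
  then show ?thesis
    unfolding welded_concordant_def using assms(1,2) M comp ends by (auto intro!: exI[of _ M])
qed

section \<open>Emptying a strand\<close>

text \<open>\<open>exchange\<close> transposes throughout the diagram, but in a Gauss diagram both
  endpoints occur only once, here side by side on \<open>c\<close>.\<close>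

lemma exchange_neighbours:
  assumes D: "gauss_diagram D" "D c = Some (x @ [e, e'] @ y)"
  shows "exchange e e' D = D(c \<mapsto> x @ [e', e] @ y)"
proof
  fix c'
  have dist: "distinct (x @ [e, e'] @ y)" using gauss_diagramD(2)[OF D] .
  show "exchange e e' D c' = (D(c \<mapsto> x @ [e', e] @ y)) c'"
  proof (cases "c' = c")
    case True
    with dist show ?thesis by (auto simp: exchange_def D(2) transpose_def intro!: map_idI)
  next
    case False
    have "map (transpose e e') w = w" if "D c' = Some w" for w
    proof -
      have "e \<notin> set w" "e' \<notin> set w" using gauss_diagramD(3)[OF D(1), of c _ c'] lies_onI[of D c, OF D(2)] lies_onI[of D c', OF that] False by auto
      then show ?thesis by (auto simp: transpose_def intro!: map_idI)
    qed
    with False show ?thesis by (cases "D c'") (auto simp: exchange_def)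
  qed
qed

text \<open>\<open>Tail a\<close> passes the endpoints of \<open>m\<close> one at a time by f1,
  which is why \<open>m\<close> must be free of heads. Each tail passed joins the prefix, so
  \<open>x\<close> varies in the induction.\<close>

lemma slide_tail:
  assumes "gauss_diagram D" "D (Strand i) = Some (x @ [Tail a] @ m @ y)"
    and "\<And>b. Head b \<notin> set m"
  shows "evolves 0 D (D(Strand i \<mapsto> x @ m @ [Tail a] @ y))"
  using assms
proof (induction m arbitrary: D x)
  case Nil
  then have "D(Strand i \<mapsto> x @ [] @ [Tail a] @ y) = D" by auto
  with Nil show ?case using evolves.stay by metis
next
  case (Cons e m)
  obtain b where e: "e = Tail b" using Cons.prems(3) by (cases e) auto
  have w: "D (Strand i) = Some (x @ [Tail a, Tail b] @ m @ y)"
    using Cons.prems(2) by (simp add: e)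
  let ?D = "D(Strand i \<mapsto> x @ [Tail b, Tail a] @ m @ y)"
  have "adjacent D (Tail a) (Tail b)"
    unfolding adjacent_def follows_def using w by fastforce
  then have "f1 D ?D"
    unfolding f1_def using exchange_neighbours[OF Cons.prems(1) w] by metis
  moreover have g: "gauss_diagram ?D"
    using gauss_diagramD(2)[OF Cons.prems(1) w] by (intro gauss_reorder[OF Cons.prems(1) w]) auto
  ultimately have 1: "evolves 0 D ?D" using evolves_f1 Cons.prems(1) by blast
  have "evolves 0 ?D (?D(Strand i \<mapsto> (x @ [Tail b]) @ m @ [Tail a] @ y))"
    using Cons.prems(3) by (intro Cons.IH g) auto
  from evolves_trans[OF this 1] show ?case
    by (simp only: e fun_upd_upd append_assoc append_Cons append_Nil add_0_left)
qed

text \<open>The earlier of the two tails slides up to the later one. Which comes first is unknown,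
  and RM2 does not care, so \<open>e\<close> and \<open>e'\<close> stand for the tails in their
  order on the strand.\<close>

lemma gather_tails:
  assumes D: "gauss_diagram D" "D (Strand i) = Some w" and "\<And>c. Head c \<notin> set w"
    and ab: "Tail a \<in> set w" "Tail b \<in> set w" "a \<noteq> b"
  obtains x e e' y where "evolves 0 D (D(Strand i \<mapsto> x @ [e, e'] @ y))" "{e, e'} = {Tail a, Tail b}"
    "filter (\<lambda>e. arrow_of e \<notin> {a, b}) w = x @ y"
proof -
  \<comment> \<open>Named here because the local \<open>if\<close> assumptions below are also called
    \<open>that\<close>.\<close>
  note result = that
  have ordered: thesis if "w = x @ [e] @ m @ [e'] @ y" "{e, e'} = {Tail a, Tail b}" for x e m e' y
  proof -
    have "evolves 0 D (D(Strand i \<mapsto> x @ m @ [e] @ [e'] @ y))"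
      using that assms(3) D ab(3) slide_tail[OF D(1), of i x _ m "[e'] @ y"]
      by (auto simp: doubleton_eq_iff)
    then have ev: "evolves 0 D (D(Strand i \<mapsto> (x @ m) @ [e, e'] @ y))" by simp
    have "distinct (x @ [e] @ m @ [e'] @ y)" using gauss_diagramD(2)[OF D] that(1) by simp
    then have tails: "e'' \<notin> {e, e'}" if "e'' \<in> set (x @ m @ y)" for e''
      using that by auto
    have heads: "Head c \<notin> set (x @ m @ y)" for c using assms(3)[of c] that(1) by simp
    have "arrow_of e'' \<notin> {a, b}" if "e'' \<in> set (x @ m @ y)" for e''
      using tails[OF that] heads that unfolding \<open>{e, e'} = _\<close>
      by (cases e'') (auto simp del: set_append)
    then have keep: "filter (\<lambda>e. arrow_of e \<notin> {a, b}) (x @ m @ y) = x @ m @ y"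
      by (intro filter_True) blast
    then have "filter (\<lambda>e. arrow_of e \<notin> {a, b}) w = (x @ m) @ y"
      using that by (auto simp: doubleton_eq_iff)
    then show thesis by (rule result[of "x @ m" e e' y, OF ev that(2)])
  qed
  obtain p q where w: "w = p @ [Tail a] @ q" using split_list[OF ab(1)] by auto
  consider "Tail b \<in> set p" | "Tail b \<in> set q" using ab w by auto
  then show thesis
  proof cases
    case 1
    then show ?thesis using ordered[of _ "Tail b" _ "Tail a"] w split_list by fastforce
  next
    case 2
    then show ?thesis using ordered[of _ "Tail a" _ "Tail b"] w split_list by fastforce
  qed
qed

text \<open>Inserting \<open>Head b, Tail b\<close> right after \<open>Head a\<close> makes the two
  heads a segment that a saddle can cut off while \<open>Tail b\<close> stays on the strand. The
  excess 1 is that saddle.\<close>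

lemma create_balanced_circle:
  assumes D: "gauss_diagram D" "D (Strand i) = Some (u @ [Head a] @ v)"
  obtains b j where "Circle j \<notin> dom D" "Tail b \<notin> endpoints D" "Head b \<notin> endpoints D"
    "writhe a = - writhe b"
    "evolves 1 D (D(Strand i \<mapsto> u @ [Tail b] @ v, Circle j \<mapsto> [Head a, Head b]))"
proof -
  \<comment> \<open>Opposite signs are what RM2 will require of \<open>a\<close> and
    \<open>b\<close>.\<close>
  obtain b where b: "positive b = (\<not> positive a)" "Tail b \<notin> endpoints D" "Head b \<notin> endpoints D"
    using fresh_arrow[OF D(1)] by blast
  obtain j where j: "Circle j \<notin> dom D" using fresh_circle[OF D(1)] .
  let ?D1 = "D(Strand i \<mapsto> u @ [Head a, Head b, Tail b] @ v)"
  let ?D2 = "?D1(Strand i \<mapsto> u @ [Tail b] @ v, Circle j \<mapsto> [Head a, Head b])"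
  have g1: "gauss_diagram ?D1"
    using gauss_insert_isolated[of D "Strand i" "u @ [Head a]" v b] D b by simp
  have "arrow_of e \<noteq> b" if "e \<in> endpoints D" for e
    using that b by (cases e) auto
  \<comment> \<open>RM1 is used backwards: deleting \<open>b\<close> from \<open>?D1\<close> must
    give back \<open>D\<close>.\<close>
  then have "delete_arrows {b} D = D" by (intro delete_arrows_idem) auto
  moreover have "delete_arrows {b} ?D1 = delete_arrows {b} D"
    using D(2) b by (auto simp: delete_arrows_def fun_eq_iff endpoints_iff lies_on_def)
  moreover have "adjacent ?D1 (Tail b) (Head b)"
  proof -
    have "?D1 (Strand i) = Some (u @ [Head a, Head b, Tail b] @ v)"
      "(u @ [Head a]) @ [Head b, Tail b] @ v \<in> readings (Strand i) (u @ [Head a, Head b, Tail b] @ v)"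
      by auto
    then show ?thesis unfolding adjacent_def follows_def by blast
  qed
  ultimately have "reidemeister D ?D1" unfolding reidemeister_def rm1_def by metis
  then have 1: "evolves 0 D ?D1" using evolves_reidemeister D(1) g1 by blast
  have w1: "?D1 (Strand i) = Some (u @ [Head a, Head b] @ [Tail b] @ v)" by simp
  have j1: "Circle j \<notin> dom ?D1" using j by simp
  have "evolves 1 ?D1 ?D2"
    using evolves_saddle[OF g1 saddle.split_strand[OF w1 j1] gauss_split[OF g1 w1 j1]] .
  from evolves_trans[OF this 1] have "evolves 1 D ?D2" by simp
  then show thesis
    using that[of j b] j b by (auto simp: writhe_def)
qed

text \<open>The heads are adjacent because they are alone on the circle, so RM2 applies and leaves
  the circle empty. Its death accounts for the excess -1.\<close>

lemma cancel_balanced_circle: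
  assumes D: "gauss_diagram D" "D (Strand i) = Some (x @ [e, e'] @ y)"
      "D (Circle j) = Some [Head a, Head b]"
    and ab: "{e, e'} = {Tail a, Tail b}" "writhe a = - writhe b"
  shows "evolves (- 1) D (D(Strand i \<mapsto> x @ y, Circle j := None))"
proof -
  let ?D = "delete_arrows {a, b} D"
  \<comment> \<open>All four endpoints of \<open>a\<close> and \<open>b\<close> are already located
    on the strand and the circle, so other components lose nothing.\<close>
  have other: "arrow_of e'' \<notin> {a, b}"
    if "D c = Some w" "e'' \<in> set w" "c \<noteq> Strand i" "c \<noteq> Circle j" for c w e''
  proof
    assume "arrow_of e'' \<in> {a, b}"
    then have "e'' \<in> set (x @ [e, e'] @ y) \<or> e'' \<in> set [Head a, Head b]"
      using ab(1) by (cases e'') (auto simp: doubleton_eq_iff)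
    then show False
      using gauss_diagramD(3)[OF D(1)] lies_onI[of D c, OF that(1,2)]
        lies_onI[of D "Strand i", OF D(2)] lies_onI[of D "Circle j", OF D(3)]
        that(3,4) by blast
  qed
  have "arrow_of e'' \<notin> {a, b}" if "e'' \<in> set (x @ y)" for e''
  proof
    assume "arrow_of e'' \<in> {a, b}"
    then consider "e'' \<in> {e, e'}" | "e'' \<in> set [Head a, Head b]"
      using ab(1) by (cases e'') (auto simp: doubleton_eq_iff)
    then show False
    proof cases
      case 1
      then show ?thesis using gauss_diagramD(2)[OF D(1,2)] that by auto
    next
      case 2
      then have "lies_on D (Circle j) e''" by (rule lies_onI[of D "Circle j", OF D(3)])
      moreover have "lies_on D (Strand i) e''"
        using that by (intro lies_onI[of D "Strand i", OF D(2)]) auto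
      ultimately have "Circle j = Strand i" by (rule gauss_diagramD(3)[OF D(1)])
      then show ?thesis by simp
    qed
  qed
  then have keep: "filter (\<lambda>e. arrow_of e \<notin> {a, b}) (x @ y) = x @ y"
    by (intro filter_True) blast
  have "?D c = (D(Strand i \<mapsto> x @ y, Circle j \<mapsto> [])) c" for c
  proof -
    consider "c = Strand i" | "c = Circle j" | "c \<noteq> Strand i" "c \<noteq> Circle j" "D c = None"
      | w where "c \<noteq> Strand i" "c \<noteq> Circle j" "D c = Some w"
      by fastforce
    then show ?thesis
    proof cases
      case 1
      then show ?thesis using keep ab(1) D(2) by (auto simp: delete_arrows_def doubleton_eq_iff)
    next
      case (4 w)
      then have "filter (\<lambda>e. arrow_of e \<notin> {a, b}) w = w"
        using other[of c w] by (intro filter_True) blast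
      with 4 show ?thesis by (simp add: delete_arrows_def)
    qed (auto simp: delete_arrows_def D(3))
  qed
  then have eq: "?D = D(Strand i \<mapsto> x @ y, Circle j \<mapsto> [])" by blast
  have "follows D e e'"
    unfolding follows_def using D(2) by fastforce
  then have "adjacent D (Tail a) (Tail b)"
    using ab(1) by (auto simp: adjacent_def doubleton_eq_iff)
  moreover have "[] @ [Head a, Head b] @ [] \<in> readings (Circle j) [Head a, Head b]"
    by (auto intro: range_eqI[of _ _ 0])
  then have "adjacent D (Head a) (Head b)"
    unfolding adjacent_def follows_def using D(3) by blast
  ultimately have "reidemeister D ?D"
    using ab(2) unfolding reidemeister_def rm2_def by blast
  then have 1: "evolves 0 D ?D"
    using evolves_reidemeister D(1) gauss_delete_arrows by blast
  have c: "?D (Circle j) = Some []" by (simp add: eq)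
  have g: "gauss_diagram ?D" using gauss_delete_arrows[OF D(1)] .
  have "evolves (- 1) D (?D(Circle j := None))"
    using evolves_trans[OF evolves_death[OF g c gauss_remove_empty[OF g c]] 1] by simp
  then show ?thesis by (simp add: eq)
qed

text \<open>
  The induction removes a head from the strand, empties the strand of all other arrows, and only
  then cancels: the tails concerned can be brought together only when no head is left between them.
\<close>

lemma clear_strand:
  assumes "gauss_diagram D" "D (Strand i) = Some w"
    and "\<And>a. Head a \<in> set w \<Longrightarrow> Tail a \<in> set w"
  shows "evolves 0 D (D(Strand i \<mapsto> filter (\<lambda>e. Head (arrow_of e) \<notin> set w) w))"
  using assms
proof (induction "card (set w \<inter> range Head)" arbitrary: D w rule: less_induct)
  case less
  note D = less.prems(1,2)
  show ?case
  proof (cases "set w \<inter> range Head = {}")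
    case True
    then have "filter (\<lambda>e. Head (arrow_of e) \<notin> set w) w = w" by (intro filter_True) auto
    then show ?thesis using evolves.stay[OF D(1)] D(2) by (simp add: fun_upd_idem)
  next
    case False
    then obtain a where "Head a \<in> set w" by auto
    then obtain u v where w: "w = u @ [Head a] @ v" using split_list by fastforce
    have dist: "distinct (u @ [Head a] @ v)" using gauss_diagramD(2)[OF D] w by simp
    obtain b j where j: "Circle j \<notin> dom D"
      and b: "Tail b \<notin> endpoints D" "Head b \<notin> endpoints D" "writhe a = - writhe b"
      and "evolves 1 D (D(Strand i \<mapsto> u @ [Tail b] @ v, Circle j \<mapsto> [Head a, Head b]))"
      using create_balanced_circle[OF D(1)] D(2) unfolding w by blast
    moreover define D2 where "D2 = D(Strand i \<mapsto> u @ [Tail b] @ v, Circle j \<mapsto> [Head a, Head b])"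
    ultimately have 1: "evolves 1 D D2" by simp
    define w2 where "w2 = u @ [Tail b] @ v"
    \<comment> \<open>What the induction hypothesis leaves on the strand. \<open>Tail a\<close> and
      \<open>Tail b\<close> survive, because their heads are now on the circle.\<close>
    define w3 where "w3 = filter (\<lambda>e. Head (arrow_of e) \<notin> set w2) w2"
    define D3 where "D3 = D2(Strand i \<mapsto> w3)"
    have bw: "Tail b \<notin> set w" "Head b \<notin> set w"
      using b(1,2) D(2) unfolding endpoints_iff lies_on_def by blast+
    have ab: "a \<noteq> b" using bw(2) w by auto
    \<comment> \<open>The measure drops: \<open>Head a\<close> has left the strand and only a tail
      replaces it.\<close>
    have "set w2 \<inter> range Head = set w \<inter> range Head - {Head a}"
      using dist by (auto simp: w w2_def)
    then have "card (set w2 \<inter> range Head) < card (set w \<inter> range Head)"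
      using \<open>Head a \<in> set w\<close> by (metis IntI List.finite_set card_Diff1_less finite_Int rangeI)
    moreover have "gauss_diagram D2" using evolves_gauss[OF 1] .
    moreover have "D2 (Strand i) = Some w2" by (simp add: D2_def w2_def)
    \<comment> \<open>The hypothesis on heads and tails is one-sided for this use:
      \<open>Tail a\<close> and \<open>Tail b\<close> lie on the strand of \<open>D2\<close> without
      their heads.\<close>
    moreover have "Tail c \<in> set w2" if "Head c \<in> set w2" for c
      using less.prems(3)[of c] that by (auto simp: w w2_def)
    ultimately have 2: "evolves 0 D2 D3" unfolding D3_def w3_def by (rule less.hyps)
    have heads: "Head c \<notin> set w3" for c by (auto simp: w3_def)
    have "Tail a \<in> set w" using less.prems(3) \<open>Head a \<in> set w\<close> by blast
    then have ta: "Tail a \<in> set w3" using dist by (auto simp: w w3_def w2_def)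
    have tb: "Tail b \<in> set w3" using bw by (auto simp: w w3_def w2_def)
    have s3: "D3 (Strand i) = Some w3" by (simp add: D3_def)
    have g3: "gauss_diagram D3" using evolves_gauss[OF 2] .
    obtain x e e' y where 3: "evolves 0 D3 (D3(Strand i \<mapsto> x @ [e, e'] @ y))"
      and e: "{e, e'} = {Tail a, Tail b}"
      and xy: "filter (\<lambda>e. arrow_of e \<notin> {a, b}) w3 = x @ y"
      by (rule gather_tails[OF g3 s3 heads ta tb ab]) (rule that)
    let ?D4 = "D3(Strand i \<mapsto> x @ [e, e'] @ y)"
    \<comment> \<open>Emptying and sliding changed only the strand, so the circle still carries its
      two heads.\<close>
    have "?D4 (Strand i) = Some (x @ [e, e'] @ y)" "?D4 (Circle j) = Some [Head a, Head b]"
      by (simp_all add: D3_def D2_def)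
    then have 4: "evolves (- 1) ?D4 (?D4(Strand i \<mapsto> x @ y, Circle j := None))"
      by (rule cancel_balanced_circle[OF evolves_gauss[OF 3] _ _ e b(3)])
    \<comment> \<open>\<open>P\<close> is the filter of the goal, \<open>Q\<close> the one of the
      induction hypothesis followed by deleting \<open>a\<close> and \<open>b\<close>. On
      \<open>u\<close> and \<open>v\<close> they agree: \<open>w\<close> and \<open>w2\<close>
      differ in heads only by \<open>Head a\<close>, both filters reject \<open>a\<close>, and
      \<open>b\<close> does not occur there.\<close>
    define P Q where "P e \<longleftrightarrow> Head (arrow_of e) \<notin> set w"
      and "Q e \<longleftrightarrow> Head (arrow_of e) \<notin> set w2 \<and> arrow_of e \<notin> {a, b}" for e
    have "P e \<longleftrightarrow> Q e" if "e \<in> set u \<union> set v" for e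
      using that bw dist by (cases e) (auto simp: P_def Q_def w w2_def)
    then have "filter P u = filter Q u" "filter P v = filter Q v" by (simp_all cong: filter_cong)
    moreover have "\<not> P (Head a)" "\<not> Q (Tail b)" by (simp_all add: P_def Q_def w)
    ultimately have "filter P w = filter Q w2" by (simp add: w w2_def)
    then have "filter (\<lambda>e. Head (arrow_of e) \<notin> set w) w = x @ y"
      unfolding xy[symmetric] w3_def filter_filter P_def Q_def .
    moreover have "?D4(Strand i \<mapsto> x @ y, Circle j := None) = D(Strand i \<mapsto> x @ y)"
      using j by (auto simp: D3_def D2_def fun_eq_iff)
    \<comment> \<open>The excesses 1, 0, 0 and -1 add up to 0.\<close>
    ultimately show ?thesis
      using evolves_trans[OF 4 evolves_trans[OF 3 evolves_trans[OF 2 1]]] by simp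
  qed
qed

theorem theorem5:
  fixes D :: diagram
  assumes "string_link_diagram 1 D"
  shows "welded_concordant 1 D (trivial_diagram 1)"
proof -
  have D: "gauss_diagram D" "dom D = {Strand 1}"
    using assms by (auto simp: string_link_diagram_def)
  then obtain w where w: "D (Strand 1) = Some w" by blast
  have none: "D c = None" if "c \<noteq> Strand 1" for c
    using D(2) that by (metis domIff singletonD)
  have ep: "e \<in> endpoints D \<longleftrightarrow> e \<in> set w" for e
    unfolding endpoints_iff lies_on_def using w none by (metis option.distinct(1) option.inject)
  have ht: "Tail a \<in> set w \<longleftrightarrow> Head a \<in> set w" for a
    using gauss_diagramD(4)[OF D(1)] unfolding ep .
  \<comment> \<open>With a single component, both endpoints of each arrow lie on \<open>w\<close>,
    so \<open>clear_strand\<close> leaves the empty word.\<close>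
  then have "Head (arrow_of e) \<in> set w" if "e \<in> set w" for e
    using that by (cases e) auto
  then have empty: "filter (\<lambda>e. Head (arrow_of e) \<notin> set w) w = []" by simp
  have trivial: "D(Strand 1 \<mapsto> []) = trivial_diagram 1"
    using none by (auto simp: trivial_diagram_def fun_eq_iff)
  have ev: "evolves 0 D (trivial_diagram 1)"
    using clear_strand[OF D(1) w] ht unfolding empty trivial by blast
  have "dom (trivial_diagram 1) = Strand ` {1..1}"
    by (auto simp: trivial_diagram_def split: if_splits)
  \<comment> \<open>That the trivial diagram is a Gauss diagram is read off from the evolution
    ending in it.\<close>
  then have "string_link_diagram 1 (trivial_diagram 1)"
    using evolves_gauss[OF ev] unfolding string_link_diagram_def by blast
  then show ?thesis using welded_concordant_1I[OF assms _ ev] by blast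
qed

end
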